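(* Let $M\ge 1$ be an integer, let $0<\alpha<1$, put $n=\lceil \alpha M\rceil$, and let $s\in(0,1)$. Consider the relaxed acceptance procedure applied to a candidate solution $x$: independent tests are performed one after another, each successful with probability $1-s$ and unsuccessful with probability $s$; the candidate is accepted as soon as the number of successful tests equals $n$, and is rejected as soon as the number of unsuccessful tests exceeds $M-n$. Let $T$ be the number of tests performed and let $B$ be the event that the candidate is accepted (which necessarily happens after some number $t$ of tests with $n\le t\le M$). Then the expected number of tests conditional on acceptance satisfies $$E[T\mid B]=\frac{\sum_{t=n}^{M} t\binom{t-1}{t-n}s^{t-n}(1-s)^n}{\sum_{t=n}^{M}\binom{t-1}{t-n}s^{t-n}(1-s)^n}<M .$$
   Context: The setting is evaluation of a candidate solution $x$ in the relaxed stochastic ruler method. A test compares one realization $h(x)$ of the random objective $H(x)$ with one realization $\theta$ of a uniform random variable on $[a,b]$ (the stochastic ruler), all draws being independent; the test is successful if $h(x)\le\theta$. Here $s=1-P(x,a,b)$, where $P(x,a,b)=\Pr(H(x)\le\theta(a,b))$. The integer $M$ is the maximum number of tests that can be performed for the candidate. In the original stochastic ruler method a candidate is accepted only if all $M$ tests succeed, so an accepted candidate always uses exactly $M$ tests; this is why $M$ is the comparison value.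
   Formalization: The strict inequality E[T|B] < M is asserted only when n < M; when n = ⌈αM⌉ = M (e.g. M = 1, α = 1/2) it fails, since then E[T|B] = M. The formula and E[T|B] ≤ M are proved in all cases. *)

theory Defs
  imports "HOL-Probability.Probability"
begin

(* X i w says that the i-th test succeeds in the outcome w; tests are numbered from 1. *)

definition successes :: "(nat \<Rightarrow> 'w \<Rightarrow> bool) \<Rightarrow> nat \<Rightarrow> 'w \<Rightarrow> nat"
  where "successes X t \<omega> = card {i \<in> {1..t}. X i \<omega>}"

definition failures :: "(nat \<Rightarrow> 'w \<Rightarrow> bool) \<Rightarrow> nat \<Rightarrow> 'w \<Rightarrow> nat"
  where "failures X t \<omega> = card {i \<in> {1..t}. \<not> X i \<omega>}"

(* For n \<le> M a stopping condition holds at the latest for t = M, since t tests with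
   fewer than n successes have more than t - n failures.  So LEAST ranges over a nonempty
   set and depends only on the tests 1, ..., M. *)
definition num_tests :: "(nat \<Rightarrow> 'w \<Rightarrow> bool) \<Rightarrow> nat \<Rightarrow> nat \<Rightarrow> 'w \<Rightarrow> nat"
  where "num_tests X M n \<omega> =
    (LEAST t. successes X t \<omega> = n \<or> failures X t \<omega> > M - n)"

(* The two stopping conditions cannot hold together at the stopping time when n \<le> M,
   because that would need more than M tests. *)
definition accepted :: "(nat \<Rightarrow> 'w \<Rightarrow> bool) \<Rightarrow> nat \<Rightarrow> nat \<Rightarrow> 'w \<Rightarrow> bool"
  where "accepted X M n \<omega> \<longleftrightarrow> successes X (num_tests X M n \<omega>) \<omega> = n"

(* E[f | B] for an event B of positive probability: the mean of f under the
   conditional probability A \<mapsto> P(A \<inter> B) / P(B). *)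
definition cond_expectation :: "'w measure \<Rightarrow> ('w \<Rightarrow> real) \<Rightarrow> 'w set \<Rightarrow> real"
  where "cond_expectation W f B = (\<integral>\<omega>. f \<omega> \<partial>(uniform_measure W B))"

end

theory Submission
  imports Defs
begin

text \<open>Acceptance after exactly \<open>t\<close> tests means that test \<open>t\<close> succeeds and that it is the
  \<open>n\<close>-th success, so the event has negative binomial probability
  \<open>(t - 1 choose t - n) s\<^sup>t\<^sup>-\<^sup>n (1 - s)\<^sup>n\<close>.  Hence \<open>E[T | B]\<close> is the average of
  \<open>n, \<dots>, M\<close> with these positive weights, which is below \<open>M\<close> as soon as \<open>n < M\<close>.\<close>

section \<open>Counts, stopping and acceptance along a fixed outcome\<close>

lemma successes_0 [simp]: "successes X 0 \<omega> = 0"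
  by (simp add: successes_def)

lemma successes_Suc:
  "successes X (Suc t) \<omega> = successes X t \<omega> + (if X (Suc t) \<omega> then 1 else 0)"
proof -
  have "{i \<in> {1..Suc t}. X i \<omega>} =
      (if X (Suc t) \<omega> then insert (Suc t) {i \<in> {1..t}. X i \<omega>} else {i \<in> {1..t}. X i \<omega>})"
    by (auto simp: le_Suc_eq)
  then show ?thesis
    by (simp add: successes_def)
qed

lemma successes_plus_failures: "successes X t \<omega> + failures X t \<omega> = t"
proof -
  have "card {i \<in> {1..t}. X i \<omega>} + card {i \<in> {1..t}. \<not> X i \<omega>} =
      card ({i \<in> {1..t}. X i \<omega>} \<union> {i \<in> {1..t}. \<not> X i \<omega>})"
    by (rule card_Un_disjoint [symmetric]) auto
  also have "{i \<in> {1..t}. X i \<omega>} \<union> {i \<in> {1..t}. \<not> X i \<omega>} = {1..t}"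
    by auto
  finally show ?thesis
    by (simp add: successes_def failures_def)
qed

lemma successes_mono: "t \<le> u \<Longrightarrow> successes X t \<omega> \<le> successes X u \<omega>"
  unfolding successes_def by (intro card_mono) auto

lemma failures_mono: "t \<le> u \<Longrightarrow> failures X t \<omega> \<le> failures X u \<omega>"
  unfolding failures_def by (intro card_mono) auto

text \<open>Discrete intermediate value property: the count starts at 0 and grows by at most one per
  test, so it skips no value.\<close>

lemma successes_intermediate:
  "m \<le> successes X t \<omega> \<Longrightarrow> \<exists>u\<le>t. successes X u \<omega> = m"
proof (induction t)
  case (Suc t)
  show ?case
  proof (cases "m \<le> successes X t \<omega>")
    case True
    then show ?thesis using Suc.IH by (meson le_SucI)
  next
    case False
    then have "successes X (Suc t) \<omega> = m"
      using Suc.prems by (simp add: successes_Suc split: if_splits)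
    then show ?thesis by blast
  qed
qed simp

text \<open>If the first \<open>M\<close> tests contain at least \<open>n\<close> successes, the
  count equals \<open>n\<close> at some time up to \<open>M\<close>. Otherwise fewer than
  \<open>n\<close> successes leave more than \<open>M - n\<close> failures.\<close>

lemma stopping_condition_reached:
  assumes "n \<le> M"
  shows "\<exists>t\<le>M. successes X t \<omega> = n \<or> failures X t \<omega> > M - n"
proof (cases "n \<le> successes X M \<omega>")
  case True
  then show ?thesis using successes_intermediate[of n X M \<omega>] by blast
next
  case False
  then have "failures X M \<omega> > M - n"
    using assms successes_plus_failures[of X M \<omega>] by linarith
  then show ?thesis by blast
qed

lemma num_tests_le:
  assumes "n \<le> M"
  shows "num_tests X M n \<omega> \<le> M"
proof -
  obtain t where "t \<le> M" "successes X t \<omega> = n \<or> failures X t \<omega> > M - n"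
    using stopping_condition_reached[OF assms, of X \<omega>] by blast
  then have "num_tests X M n \<omega> \<le> t"
    unfolding num_tests_def by (intro Least_le)
  then show ?thesis
    using \<open>t \<le> M\<close> by simp
qed

lemma accepted_imp_le_num_tests: "accepted X M n \<omega> \<Longrightarrow> n \<le> num_tests X M n \<omega>"
  unfolding accepted_def using successes_plus_failures by (metis le_add1)

text \<open>Removes the minimum from the description of acceptance at time \<open>t\<close>: the
  right-hand side depends on the first \<open>t\<close> tests only, so its probability can be
  computed by counting success patterns.\<close>

lemma accepted_at_iff:
  assumes "1 \<le> n" "n \<le> M" "1 \<le> t" "t \<le> M"
  shows "accepted X M n \<omega> \<and> num_tests X M n \<omega> = t \<longleftrightarrow> successes X t \<omega> = n \<and> X t \<omega>"
proof -
  obtain u where t: "t = Suc u"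
    using assms(3) by (cases t) auto
  show ?thesis
  proof
    assume *: "accepted X M n \<omega> \<and> num_tests X M n \<omega> = t"
    then have succ: "successes X t \<omega> = n"
      by (auto simp: accepted_def)
    \<comment> \<open>Since \<open>u\<close> precedes the least stopping index, the count was not
      yet \<open>n\<close> there, so it must have changed at test \<open>t\<close>.\<close>
    moreover have "successes X u \<omega> \<noteq> n"
      using * not_less_Least[of u "\<lambda>t. successes X t \<omega> = n \<or> failures X t \<omega> > M - n"]
      by (simp add: num_tests_def t)
    ultimately show "successes X t \<omega> = n \<and> X t \<omega>"
      by (auto simp: t successes_Suc split: if_splits)
  next
    assume *: "successes X t \<omega> = n \<and> X t \<omega>"
    have "num_tests X M n \<omega> = t"
      unfolding num_tests_def
    proof (rule Least_equality)
      fix v assume v: "successes X v \<omega> = n \<or> failures X v \<omega> > M - n"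
      show "t \<le> v"
      proof (rule ccontr)
        assume "\<not> t \<le> v"
        then have "v \<le> u" by (simp add: t)
        \<comment> \<open>Test \<open>t\<close> is itself a success, so the count at
          \<open>u\<close> is \<open>n - 1\<close>, and earlier counts are no larger.\<close>
        then have "successes X v \<omega> < n"
          using * successes_mono[of v u X \<omega>] by (auto simp: t successes_Suc)
        \<comment> \<open>By time \<open>t\<close> there are exactly \<open>t - n\<close> failures,
          and \<open>t \<le> M\<close> keeps this within the limit, so no rejection has happened
          before.\<close>
        moreover have "failures X v \<omega> \<le> M - n"
          using * \<open>v \<le> u\<close> failures_mono[of v t X \<omega>] successes_plus_failures[of X t \<omega>] assms
          by (simp add: t)
        ultimately show False using v by simp
      qed
    qed (use * in simp)
    then show "accepted X M n \<omega> \<and> num_tests X M n \<omega> = t"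
      using * by (simp add: accepted_def)
  qed
qed

section \<open>Counting success patterns that end in a success\<close>

lemma card_subsets_containing_last:
  assumes "1 \<le> n" "n \<le> t"
  shows "card {J. J \<subseteq> {1..t} \<and> card J = n \<and> t \<in> J} = (t - 1) choose (t - n)"
proof -
  have fin: "finite K" if "K \<subseteq> {1..t - 1}" for K :: "nat set"
    using that finite_subset by blast
  \<comment> \<open>The last position is forced, so only the other \<open>n - 1\<close> positions
    among the first \<open>t - 1\<close> are free; deleting \<open>t\<close> recovers them.\<close>
  have "bij_betw (insert t) {K. K \<subseteq> {1..t - 1} \<and> card K = n - 1}
      {J. J \<subseteq> {1..t} \<and> card J = n \<and> t \<in> J}"
  proof (rule bij_betw_byWitness[where f' = "\<lambda>J. J - {t}"])
    show "insert t ` {K. K \<subseteq> {1..t - 1} \<and> card K = n - 1} \<subseteq> {J. J \<subseteq> {1..t} \<and> card J = n \<and> t \<in> J}"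
    proof clarify
      fix K assume K: "K \<subseteq> {1..t - 1}" "card K = n - 1"
      then have "t \<notin> K" using assms by auto
      then have "card (insert t K) = n"
        using K fin assms by simp
      then show "insert t K \<subseteq> {1..t} \<and> card (insert t K) = n \<and> t \<in> insert t K"
        using subset_trans[OF K(1), of "{1..t}"] assms by simp
    qed
    show "(\<lambda>J. J - {t}) ` {J. J \<subseteq> {1..t} \<and> card J = n \<and> t \<in> J}
        \<subseteq> {K. K \<subseteq> {1..t - 1} \<and> card K = n - 1}"
      using assms by (fastforce simp: card_Diff_singleton)
    show "\<forall>K\<in>{K. K \<subseteq> {1..t - 1} \<and> card K = n - 1}. insert t K - {t} = K"
      using assms by fastforce
  qed auto
  then have "card {J. J \<subseteq> {1..t} \<and> card J = n \<and> t \<in> J} =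
      card {K. K \<subseteq> {1..t - 1} \<and> card K = n - 1}"
    by (simp add: bij_betw_same_card)
  also have "\<dots> = (t - 1) choose (n - 1)"
    using n_subsets[of "{1..t - 1}" "n - 1"] by simp
  \<comment> \<open>Choosing the positions of the \<open>n - 1\<close> earlier successes amounts to
    choosing those of the \<open>t - n\<close> failures.\<close>
  also have "\<dots> = (t - 1) choose (t - n)"
    using assms binomial_symmetric[of "n - 1" "t - 1"] by simp
  finally show ?thesis .
qed

section \<open>Probabilities of success patterns\<close>

context prob_space
begin

text \<open>A full pattern imposes one condition on each test, so independence makes its probability
  a product of factors \<open>p\<close> and \<open>1 - p\<close>. Here \<open>M\<close> is the
  probability measure, and \<open>N\<close> is the maximum number of tests.\<close>

lemma prob_success_pattern:
  fixes X :: "nat \<Rightarrow> 'a \<Rightarrow> bool"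
  assumes indep: "indep_vars (\<lambda>_. count_space UNIV) X {1..N}"
    and p: "\<And>i. i \<in> {1..N} \<Longrightarrow> prob {\<omega> \<in> space M. X i \<omega>} = p"
    and "1 \<le> t" "t \<le> N" "J \<subseteq> {1..t}"
  shows "prob {\<omega> \<in> space M. {i \<in> {1..t}. X i \<omega>} = J} = p ^ card J * (1 - p) ^ (t - card J)"
proof -
  define A where "A i = (if i \<in> J then {True} else {False})" for i
  have meas: "X i \<in> measurable M (count_space UNIV)" if "i \<in> {1..N}" for i
    using indep that by (auto simp: indep_vars_def)
  have single: "prob (X i -` A i \<inter> space M) = (if i \<in> J then p else 1 - p)" if "i \<in> {1..t}" for i
  proof -
    have i: "i \<in> {1..N}" using that assms by auto
    have S: "{\<omega> \<in> space M. X i \<omega>} \<in> events"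
      using measurable_sets[OF meas[OF i], of "{True}"] by (simp add: vimage_def Int_def conj_commute)
    have "X i -` A i \<inter> space M =
        (if i \<in> J then {\<omega> \<in> space M. X i \<omega>} else space M - {\<omega> \<in> space M. X i \<omega>})"
      by (auto simp: A_def)
    then show ?thesis
      using p[OF i] prob_compl[OF S] by simp
  qed
  \<comment> \<open>Here \<open>1 \<le> t\<close> matters: an intersection over the empty index set
    would be the whole type instead of \<open>space M\<close>.\<close>
  have "{\<omega> \<in> space M. {i \<in> {1..t}. X i \<omega>} = J} = (\<Inter>i\<in>{1..t}. X i -` A i \<inter> space M)"
    using assms by (fastforce simp: A_def split: if_splits)
  then have "prob {\<omega> \<in> space M. {i \<in> {1..t}. X i \<omega>} = J} =
      (\<Prod>i\<in>{1..t}. prob (X i -` A i \<inter> space M))"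
    using indep_varsD[OF indep, of "{1..t}" A] assms by simp
  also have "\<dots> = (\<Prod>i\<in>{1..t}. if i \<in> J then p else 1 - p)"
    using single by (intro prod.cong) auto
  also have "\<dots> = p ^ card J * (1 - p) ^ card ({1..t} - J)"
  proof -
    have "{1..t} \<inter> {i. i \<in> J} = J" "{1..t} \<inter> - {i. i \<in> J} = {1..t} - J"
      using assms by auto
    then show ?thesis
      by (simp only: prod.If_cases finite_atLeastAtMost prod_constant)
  qed
  also have "card ({1..t} - J) = t - card J"
    using assms by (simp add: card_Diff_subset finite_subset)
  finally show ?thesis .
qed

text \<open>The success set takes only finitely many values, so any predicate \<open>P\<close> of it
  cuts out a finite union of pattern events. This gives measurability of everything decided by the
  first \<open>t\<close> tests.\<close>

lemma events_success_set:
  fixes X :: "nat \<Rightarrow> 'a \<Rightarrow> bool"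
  assumes "\<And>i. i \<in> {1..t} \<Longrightarrow> X i \<in> measurable M (count_space UNIV)"
  shows "{\<omega> \<in> space M. P {i \<in> {1..t}. X i \<omega>}} \<in> events"
proof -
  define S where "S \<omega> = {i \<in> {1..t}. X i \<omega>}" for \<omega>
  have sub: "S \<omega> \<subseteq> {1..t}" for \<omega>
    by (auto simp: S_def)
  then have "{\<omega> \<in> space M. P (S \<omega>)} =
      (\<Union>J\<in>{J \<in> Pow {1..t}. P J}. {\<omega> \<in> space M. S \<omega> = J})"
    by auto
  also have "\<dots> \<in> events"
  proof (intro sets.finite_UN)
    fix J assume "J \<in> {J \<in> Pow {1..t}. P J}"
    then have "{\<omega> \<in> space M. S \<omega> = J} = {\<omega> \<in> space M. \<forall>i\<in>{1..t}. X i \<omega> = (i \<in> J)}"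
      by (auto simp: S_def)
    also have "\<dots> \<in> events"
      using assms by measurable
    finally show "{\<omega> \<in> space M. S \<omega> = J} \<in> events" .
  qed auto
  finally show ?thesis
    by (simp only: S_def)
qed

text \<open>The event splits into disjoint patterns with \<open>n\<close> successes, the last one at
  \<open>t\<close>. All have the same probability, so only their number remains to be
  inserted.\<close>

lemma prob_success_at:
  fixes X :: "nat \<Rightarrow> 'a \<Rightarrow> bool"
  assumes indep: "indep_vars (\<lambda>_. count_space UNIV) X {1..N}"
    and p: "\<And>i. i \<in> {1..N} \<Longrightarrow> prob {\<omega> \<in> space M. X i \<omega>} = p"
    and "1 \<le> n" "n \<le> t" "t \<le> N"
  shows "prob {\<omega> \<in> space M. successes X t \<omega> = n \<and> X t \<omega>} =
    real ((t - 1) choose (t - n)) * (1 - p) ^ (t - n) * p ^ n"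
proof -
  let ?\<J> = "{J. J \<subseteq> {1..t} \<and> card J = n \<and> t \<in> J}"
  have meas: "X i \<in> measurable M (count_space UNIV)" if "i \<in> {1..t}" for i
    using indep that assms by (auto simp: indep_vars_def)
  have "{\<omega> \<in> space M. successes X t \<omega> = n \<and> X t \<omega>} =
      (\<Union>J\<in>?\<J>. {\<omega> \<in> space M. {i \<in> {1..t}. X i \<omega>} = J})"
    using assms by (auto simp: successes_def)
  also have "prob \<dots> = (\<Sum>J\<in>?\<J>. prob {\<omega> \<in> space M. {i \<in> {1..t}. X i \<omega>} = J})"
  proof (rule finite_measure_finite_Union)
    show "finite ?\<J>" by simp
    show "(\<lambda>J. {\<omega> \<in> space M. {i \<in> {1..t}. X i \<omega>} = J}) ` ?\<J> \<subseteq> events"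
      using events_success_set[of t X "\<lambda>K. K = J" for J, OF meas] by auto
    show "disjoint_family_on (\<lambda>J. {\<omega> \<in> space M. {i \<in> {1..t}. X i \<omega>} = J}) ?\<J>"
      by (auto simp: disjoint_family_on_def)
  qed
  also have "\<dots> = (\<Sum>J\<in>?\<J>. p ^ n * (1 - p) ^ (t - n))"
  proof (intro sum.cong refl)
    fix J assume "J \<in> ?\<J>"
    then show "prob {\<omega> \<in> space M. {i \<in> {1..t}. X i \<omega>} = J} = p ^ n * (1 - p) ^ (t - n)"
      using prob_success_pattern[OF indep p, of t J] assms(3-5) by auto
  qed
  also have "\<dots> = real (card ?\<J>) * (p ^ n * (1 - p) ^ (t - n))"
    by simp
  finally show ?thesis
    using card_subsets_containing_last[of n t] assms by (simp add: mult_ac)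
qed

section \<open>Conditional expectation of a variable with finitely many values on the event\<close>

lemma cond_expectation_discrete:
  fixes f :: "'a \<Rightarrow> nat"
  assumes "finite I"
    and A: "\<And>t. t \<in> I \<Longrightarrow> {\<omega> \<in> B. f \<omega> = t} \<in> events"
    and B: "B \<in> events" "prob B > 0" "\<And>\<omega>. \<omega> \<in> B \<Longrightarrow> f \<omega> \<in> I"
    and f: "f \<in> measurable M (count_space UNIV)"
  shows "cond_expectation M (\<lambda>\<omega>. real (f \<omega>)) B =
    (\<Sum>t\<in>I. real t * prob {\<omega> \<in> B. f \<omega> = t}) / (\<Sum>t\<in>I. prob {\<omega> \<in> B. f \<omega> = t})"
proof -
  let ?U = "uniform_measure M B"
  let ?A = "\<lambda>t. {\<omega> \<in> B. f \<omega> = t}"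
  have emB: "emeasure M B \<noteq> 0" "emeasure M B \<noteq> \<infinity>"
    using B by (auto simp: emeasure_eq_measure)
  interpret U: prob_space ?U
    using emB by (rule prob_space_uniform_measure)
  have U: "measure ?U (?A t) = prob (?A t) / prob B" if "t \<in> I" for t
  proof -
    have "B \<inter> ?A t = ?A t" by auto
    then show ?thesis
      using emB A[OF that] by simp
  qed
  \<comment> \<open>The level sets of \<open>f\<close> partition \<open>B\<close>, which turns the
    normalizing constant into the denominator sum.\<close>
  have "prob B = (\<Sum>t\<in>I. prob (?A t))"
  proof -
    have "B = (\<Union>t\<in>I. ?A t)" using B(3) by auto
    moreover have "prob (\<Union>t\<in>I. ?A t) = (\<Sum>t\<in>I. prob (?A t))"
      using A \<open>finite I\<close> by (intro finite_measure_finite_Union) (auto simp: disjoint_family_on_def)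
    ultimately show ?thesis by simp
  qed
  moreover have "cond_expectation M (\<lambda>\<omega>. real (f \<omega>)) B =
      (\<integral>\<omega>. (\<Sum>t\<in>I. real t * indicator (?A t) \<omega>) \<partial>?U)"
    unfolding cond_expectation_def
  proof (rule integral_cong_AE)
    show "(\<lambda>\<omega>. real (f \<omega>)) \<in> borel_measurable ?U"
      using f by measurable
    show "(\<lambda>\<omega>. \<Sum>t\<in>I. real t * indicator (?A t) \<omega>) \<in> borel_measurable ?U"
      using A by (intro borel_measurable_sum borel_measurable_times borel_measurable_indicator) auto
    \<comment> \<open>The conditional measure gives no mass to the complement of \<open>B\<close>,
      so \<open>f\<close> may be replaced by a simple function that agrees with it on
      \<open>B\<close> only.\<close>
    show "AE \<omega> in ?U. real (f \<omega>) = (\<Sum>t\<in>I. real t * indicator (?A t) \<omega>)"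
    proof (rule AE_uniform_measureI[OF B(1)], rule AE_I2, rule impI)
      fix \<omega> assume "\<omega> \<in> B"
      then have "(\<Sum>t\<in>I. real t * indicator (?A t) \<omega>) = (\<Sum>t\<in>I. if t = f \<omega> then real t else 0)"
        by (intro sum.cong) (auto simp: indicator_def)
      then show "real (f \<omega>) = (\<Sum>t\<in>I. real t * indicator (?A t) \<omega>)"
        using \<open>finite I\<close> B(3)[OF \<open>\<omega> \<in> B\<close>] by simp
    qed
  qed
  moreover have "\<dots> = (\<Sum>t\<in>I. \<integral>\<omega>. real t * indicator (?A t) \<omega> \<partial>?U)"
    using A by (intro Bochner_Integration.integral_sum integrable_mult_right)
      (auto intro!: integrable_real_indicator simp: U.emeasure_eq_measure)
  moreover have "\<dots> = (\<Sum>t\<in>I. real t * prob (?A t)) / prob B"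
  proof -
    have "(\<integral>\<omega>. real t * indicator (?A t) \<omega> \<partial>?U) = real t * prob (?A t) / prob B" if "t \<in> I" for t
    proof -
      have "?A t \<inter> space M = ?A t"
        using sets.sets_into_space[OF A[OF that]] by auto
      then show ?thesis by (simp add: U[OF that])
    qed
    then show ?thesis by (simp add: sum_divide_distrib)
  qed
  ultimately show ?thesis by simp
qed

text \<open>Nothing is assumed about \<open>X i\<close> for \<open>i > N\<close>, so measurability of \<open>num_tests\<close> depends on
  the bound \<open>n \<le> N\<close>.\<close>

lemma measurable_num_tests:
  fixes X :: "nat \<Rightarrow> 'a \<Rightarrow> bool"
  assumes X: "\<And>i. i \<in> {1..N} \<Longrightarrow> X i \<in> measurable M (count_space UNIV)"
    and "n \<le> N"
  shows "num_tests X N n \<in> measurable M (count_space UNIV)"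
proof -
  \<comment> \<open>Cutting the search off at \<open>N\<close> leaves the least index unchanged,
    because a stopping condition holds by then. It makes each \<open>Q t\<close> an event decided by
    the tests \<open>1, ..., N\<close>.\<close>
  define Q where "Q t \<omega> \<longleftrightarrow> t \<le> N \<and> (successes X t \<omega> = n \<or> failures X t \<omega> > N - n)" for t \<omega>
  have "num_tests X N n = (\<lambda>\<omega>. LEAST t. Q t \<omega>)"
  proof
    fix \<omega>
    obtain t where "t \<le> N" and t: "successes X t \<omega> = n \<or> failures X t \<omega> > N - n"
      using stopping_condition_reached[OF \<open>n \<le> N\<close>, of X \<omega>] by blast
    show "num_tests X N n \<omega> = (LEAST t. Q t \<omega>)"
      unfolding num_tests_def
    proof (rule Least_equality)
      have "Q (LEAST t. Q t \<omega>) \<omega>"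
        using t \<open>t \<le> N\<close> by (intro LeastI[of "\<lambda>t. Q t \<omega>" t]) (simp add: Q_def)
      then show "successes X (LEAST t. Q t \<omega>) \<omega> = n \<or> N - n < failures X (LEAST t. Q t \<omega>) \<omega>"
        by (simp add: Q_def)
    next
      fix v assume v: "successes X v \<omega> = n \<or> N - n < failures X v \<omega>"
      show "(LEAST t. Q t \<omega>) \<le> v"
      proof (cases "v \<le> N")
        case True
        then show ?thesis using v by (intro Least_le[of "\<lambda>t. Q t \<omega>"]) (simp add: Q_def)
      next
        case False
        have "(LEAST t. Q t \<omega>) \<le> t"
          using t \<open>t \<le> N\<close> by (intro Least_le[of "\<lambda>t. Q t \<omega>"]) (simp add: Q_def)
        then show ?thesis using False \<open>t \<le> N\<close> by simp
      qed
    qed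
  qed
  moreover have "(\<lambda>\<omega>. LEAST t. Q t \<omega>) \<in> measurable M (count_space UNIV)"
  proof (rule measurable_Least)
    fix t
    have "{\<omega> \<in> space M. Q t \<omega>} \<in> events"
    proof (cases "t \<le> N")
      case True
      have "failures X t \<omega> = t - successes X t \<omega>" for \<omega>
        using successes_plus_failures[of X t \<omega>] by simp
      then have "{\<omega> \<in> space M. Q t \<omega>} = {\<omega> \<in> space M.
          card {i \<in> {1..t}. X i \<omega>} = n \<or> t - card {i \<in> {1..t}. X i \<omega>} > N - n}"
        using True by (simp add: Q_def successes_def)
      also have "\<dots> \<in> events"
        using X True by (intro events_success_set[where P = "\<lambda>J. card J = n \<or> t - card J > N - n"]) auto
      finally show ?thesis .
    qed (simp add: Q_def)
    then show "(\<lambda>\<omega>. Q t \<omega>) \<in> measurable M (count_space UNIV)"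
      by (simp add: pred_def)
  qed
  ultimately show ?thesis by simp
qed

end

text \<open>If \<open>\<alpha> * M > M - 1\<close>, rounding up gives \<open>n = M\<close>; every
  accepted run then takes exactly \<open>M\<close> tests and the conditional expectation equals
  \<open>M\<close>. Hence the strict bound is stated for \<open>n < M\<close>, and the weak one in
  general.\<close>

theorem mainTheorem1:
  fixes W :: "'w measure" and X :: "nat \<Rightarrow> 'w \<Rightarrow> bool"
    and M n :: nat and \<alpha> s :: real
    and T :: "'w \<Rightarrow> nat" and B :: "'w set"
  assumes "M \<ge> 1"
    and "0 < \<alpha>" and "\<alpha> < 1"
    and n: "n = nat \<lceil>\<alpha> * real M\<rceil>"
    and "0 < s" and "s < 1"
    and "prob_space W"
    and indep: "prob_space.indep_vars W (\<lambda>_. count_space UNIV) X {1..M}"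
    and success_prob: "\<And>i. i \<in> {1..M} \<Longrightarrow> measure W {\<omega> \<in> space W. X i \<omega>} = 1 - s"
    and T: "T = num_tests X M n"
    and B: "B = {\<omega> \<in> space W. accepted X M n \<omega>}"
  shows "(\<forall>\<omega> \<in> B. n \<le> T \<omega> \<and> T \<omega> \<le> M) \<and>
    cond_expectation W (\<lambda>\<omega>. real (T \<omega>)) B =
      (\<Sum>t = n..M. real t * real ((t - 1) choose (t - n)) * s ^ (t - n) * (1 - s) ^ n) /
      (\<Sum>t = n..M. real ((t - 1) choose (t - n)) * s ^ (t - n) * (1 - s) ^ n) \<and>
    cond_expectation W (\<lambda>\<omega>. real (T \<omega>)) B \<le> real M \<and>
    (n < M \<longrightarrow> cond_expectation W (\<lambda>\<omega>. real (T \<omega>)) B < real M)"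
proof -
  interpret prob_space W by fact
  have "1 \<le> n"
  proof -
    have "0 < \<alpha> * real M" using assms by simp
    then show ?thesis unfolding n by linarith
  qed
  have "n \<le> M"
  proof -
    have "\<alpha> * real M \<le> real M" using assms by (simp add: mult_left_le_one_le)
    then show ?thesis unfolding n by linarith
  qed
  define p where "p t = real ((t - 1) choose (t - n)) * s ^ (t - n) * (1 - s) ^ n" for t
  have bounds: "\<forall>\<omega>\<in>B. n \<le> T \<omega> \<and> T \<omega> \<le> M"
    using num_tests_le[OF \<open>n \<le> M\<close>] by (auto simp: B T accepted_imp_le_num_tests)
  have X: "X i \<in> measurable W (count_space UNIV)" if "i \<in> {1..M}" for i
    using indep that by (auto simp: indep_vars_def)
  have A_eq: "{\<omega> \<in> B. T \<omega> = t} = {\<omega> \<in> space W. successes X t \<omega> = n \<and> X t \<omega>}"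
    if "t \<in> {n..M}" for t
    using accepted_at_iff[OF \<open>1 \<le> n\<close> \<open>n \<le> M\<close>, of t X] that \<open>1 \<le> n\<close> unfolding B T by auto
  have A_events: "{\<omega> \<in> B. T \<omega> = t} \<in> events" if "t \<in> {n..M}" for t
  proof -
    \<comment> \<open>Rewritten as a predicate of the success set, with \<open>X t\<close> expressed
      as membership of \<open>t\<close>, to fit \<open>events_success_set\<close>.\<close>
    have "{\<omega> \<in> B. T \<omega> = t} =
        {\<omega> \<in> space W. card {i \<in> {1..t}. X i \<omega>} = n \<and> t \<in> {i \<in> {1..t}. X i \<omega>}}"
      using that \<open>1 \<le> n\<close> by (auto simp: A_eq successes_def)
    also have "\<dots> \<in> events"
      using X that by (intro events_success_set[where P = "\<lambda>J. card J = n \<and> t \<in> J"]) auto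
    finally show ?thesis .
  qed
  have A_prob: "prob {\<omega> \<in> B. T \<omega> = t} = p t" if "t \<in> {n..M}" for t
    using prob_success_at[OF indep success_prob \<open>1 \<le> n\<close>, of t] that by (simp add: A_eq p_def)
  have p_pos: "p t > 0" if "t \<in> {n..M}" for t
    using that assms \<open>1 \<le> n\<close> by (simp add: p_def)
  have sum_pos: "sum p {n..M} > 0"
    using p_pos \<open>n \<le> M\<close> by (intro sum_pos) auto
  have B_eq: "B = (\<Union>t\<in>{n..M}. {\<omega> \<in> B. T \<omega> = t})"
    using bounds by auto
  have B_events: "B \<in> events"
    using A_events by (subst B_eq) (intro sets.finite_UN, auto)
  \<comment> \<open>Conditioning needs \<open>B\<close> to have positive probability. Acceptance by
    \<open>n\<close> immediate successes already contributes
    \<open>p n = (1 - s) ^ n\<close>.\<close>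
  have "p n \<le> prob B"
    using A_prob[of n] \<open>n \<le> M\<close> finite_measure_mono[OF _ B_events, of "{\<omega> \<in> B. T \<omega> = n}"] by auto
  then have "prob B > 0"
    using p_pos[of n] \<open>n \<le> M\<close> by simp
  then have "cond_expectation W (\<lambda>\<omega>. real (T \<omega>)) B =
      (\<Sum>t\<in>{n..M}. real t * prob {\<omega> \<in> B. T \<omega> = t}) / (\<Sum>t\<in>{n..M}. prob {\<omega> \<in> B. T \<omega> = t})"
    using A_events B_events bounds measurable_num_tests[OF X \<open>n \<le> M\<close>]
    by (intro cond_expectation_discrete) (auto simp: T)
  then have E: "cond_expectation W (\<lambda>\<omega>. real (T \<omega>)) B = (\<Sum>t\<in>{n..M}. real t * p t) / sum p {n..M}"
    using A_prob by simp
  have "(\<Sum>t\<in>{n..M}. real t * p t) \<le> (\<Sum>t\<in>{n..M}. real M * p t)"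
    using p_pos by (intro sum_mono mult_right_mono) (auto simp: less_imp_le)
  then have le: "cond_expectation W (\<lambda>\<omega>. real (T \<omega>)) B \<le> real M"
    using sum_pos by (simp add: E divide_le_eq sum_distrib_left)
  have less: "cond_expectation W (\<lambda>\<omega>. real (T \<omega>)) B < real M" if "n < M"
  proof -
    have "(\<Sum>t\<in>{n..M}. real t * p t) < (\<Sum>t\<in>{n..M}. real M * p t)"
    proof (rule sum_strict_mono_ex1)
      show "\<forall>t\<in>{n..M}. real t * p t \<le> real M * p t"
        using p_pos by (auto intro!: mult_right_mono simp: less_imp_le)
      \<comment> \<open>The shortest accepted run, \<open>t = n\<close>, has positive weight and
        lies strictly below \<open>M\<close>.\<close>
      show "\<exists>t\<in>{n..M}. real t * p t < real M * p t"
        using p_pos[of n] that by (intro bexI[of _ n]) auto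
    qed simp
    then show ?thesis
      using sum_pos by (simp add: E divide_less_eq sum_distrib_left)
  qed
  show ?thesis
    using bounds E le less by (simp add: p_def mult.assoc)
qed

end
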